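(* Let $a$ be any positive integer. For any positive integer $n$ and any prime $p$ with $p\nmid n$, we have $$(-x)^n\sum_{k=1}^{p^a-1}\frac{B_k(x)}{(-n)^k}\equiv -\sum_{r=1}^{a}x^{p^r}\sum_{k=0}^{n-1}\frac{(n-1)!}{k!}(-x)^k\pmod{p\mathbb{Z}_p[x]},$$ where $B_k(x)$ is the Bell polynomial of degree $k$ and $\mathbb{Z}_p$ is the ring of $p$-adic integers.
   Context: For integers $m\ge k\ge0$, $S(m,k)$ denotes the Stirling number of the second kind: the number of ways to partition $\{1,\dots,m\}$ into $k$ disjoint nonempty parts, with the convention $S(0,0)=1$ (and $S(m,0)=0$ for $m\ge1$). The Bell (Touchard) polynomial of degree $m$ is $B_m(x)=\sum_{k=0}^m S(m,k)x^k$. A congruence $f\equiv g\pmod{p\mathbb{Z}_p[x]}$ for polynomials $f,g\in\mathbb{Z}_p[x]$ means $f-g\in p\mathbb{Z}_p[x]$, i.e. all coefficients of $f-g$ are divisible by $p$ in $\mathbb{Z}_p$. *)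

theory Defs
  imports
    "HOL-Algebra.UnivPoly"
    "HOL-Combinatorics.Stirling"
    "HOL-Computational_Algebra.Primes"
    "HOL-Number_Theory.Cong"
begin

text \<open>
  The ring of \<open>p\<close>-adic integers as the inverse limit of the rings of integers modulo \<open>p ^ i\<close>:
  an element is a coherent sequence of residues, the \<open>i\<close>-th one represented in \<open>{0..<p ^ i}\<close>.
\<close>

definition padic_ints :: "nat \<Rightarrow> (nat \<Rightarrow> int) ring" where
  "padic_ints p =
    \<lparr>carrier = {x. \<forall>i. x i \<in> {0..<int p ^ i} \<and> x (Suc i) mod int p ^ i = x i},
     monoid.mult = (\<lambda>x y i. (x i * y i) mod int p ^ i),
     one = (\<lambda>i. 1 mod int p ^ i),
     zero = (\<lambda>i. 0),
     add = (\<lambda>x y i. (x i + y i) mod int p ^ i)\<rparr>"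

abbreviation padic_poly :: "nat \<Rightarrow> (nat \<Rightarrow> int, nat \<Rightarrow> (nat \<Rightarrow> int)) up_ring" where
  "padic_poly p \<equiv> UP (padic_ints p)"

abbreviation (input) poly_var :: "('a, 'm) ring_scheme \<Rightarrow> (nat \<Rightarrow> 'a)" where
  "poly_var R \<equiv> monom (UP R) \<one>\<^bsub>R\<^esub> 1"

definition bell_poly :: "('a, 'm) ring_scheme \<Rightarrow> nat \<Rightarrow> (nat \<Rightarrow> 'a)" where
  "bell_poly R m =
    (\<Oplus>\<^bsub>UP R\<^esub>k\<in>{0..m}. [Stirling m k] \<cdot>\<^bsub>UP R\<^esub> (poly_var R [^]\<^bsub>UP R\<^esub> k))"

definition padic_poly_cong :: "nat \<Rightarrow> (nat \<Rightarrow> (nat \<Rightarrow> int)) \<Rightarrow> (nat \<Rightarrow> (nat \<Rightarrow> int)) \<Rightarrow> bool" where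
  "padic_poly_cong p f g \<longleftrightarrow>
    f \<in> carrier (padic_poly p) \<and> g \<in> carrier (padic_poly p) \<and>
    f \<ominus>\<^bsub>padic_poly p\<^esub> g \<in> {[p] \<cdot>\<^bsub>padic_poly p\<^esub> h | h. h \<in> carrier (padic_poly p)}"

lemma padic_ints_carrierI:
  assumes "p > 0" "\<And>i. [y (Suc i) = y i] (mod int p ^ i)"
  shows "(\<lambda>i. y i mod int p ^ i) \<in> carrier (padic_ints p)"
  using assms by (auto simp: padic_ints_def cong_def mod_mod_cancel)

lemma padic_ints_carrier_cong:
  assumes "x \<in> carrier (padic_ints p)"
  shows "[x (Suc i) = x i] (mod int p ^ i)" "x i mod int p ^ i = x i"
  using assms by (auto simp: padic_ints_def cong_def)

lemma cring_padic_ints: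
  assumes "p > 0"
  shows "cring (padic_ints p)"
proof (intro cringI abelian_groupI comm_monoidI)
  fix x assume x: "x \<in> carrier (padic_ints p)"
  have "(\<lambda>i. (- x i) mod int p ^ i) \<in> carrier (padic_ints p)"
    using assms x
    by (intro padic_ints_carrierI) (auto simp: cong_minus_minus_iff padic_ints_carrier_cong)
  moreover have "(\<lambda>i. (- x i) mod int p ^ i) \<oplus>\<^bsub>padic_ints p\<^esub> x = \<zero>\<^bsub>padic_ints p\<^esub>"
    by (auto simp: padic_ints_def mod_simps)
  ultimately show "\<exists>y\<in>carrier (padic_ints p). y \<oplus>\<^bsub>padic_ints p\<^esub> x = \<zero>\<^bsub>padic_ints p\<^esub>"
    by blast
next
  fix x y assume "x \<in> carrier (padic_ints p)" "y \<in> carrier (padic_ints p)"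
  then have "(\<lambda>i. (x i + y i) mod int p ^ i) \<in> carrier (padic_ints p)"
    "(\<lambda>i. (x i * y i) mod int p ^ i) \<in> carrier (padic_ints p)"
    using assms
    by (auto intro!: padic_ints_carrierI cong_add cong_mult simp: padic_ints_carrier_cong)
  then show "x \<oplus>\<^bsub>padic_ints p\<^esub> y \<in> carrier (padic_ints p)"
    "x \<otimes>\<^bsub>padic_ints p\<^esub> y \<in> carrier (padic_ints p)"
    by (simp_all add: padic_ints_def)
next
  show "\<one>\<^bsub>padic_ints p\<^esub> \<in> carrier (padic_ints p)"
    using padic_ints_carrierI[OF assms, of "\<lambda>_. 1"] by (simp add: padic_ints_def)
next
  show "\<zero>\<^bsub>padic_ints p\<^esub> \<in> carrier (padic_ints p)"
    using assms by (simp add: padic_ints_def)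
qed (auto simp: padic_ints_def mod_simps algebra_simps fun_eq_iff)

lemma padic_ints_of_nat: "[(n::nat)] \<cdot>\<^bsub>padic_ints p\<^esub> \<one>\<^bsub>padic_ints p\<^esub> = (\<lambda>i. int n mod int p ^ i)"
  by (induction n) (auto simp: add_pow_def nat_pow_def padic_ints_def mod_simps algebra_simps)

lemma of_nat_Units_padic_ints:
  assumes "prime p" "\<not> p dvd n"
  shows "[n] \<cdot>\<^bsub>padic_ints p\<^esub> \<one>\<^bsub>padic_ints p\<^esub> \<in> Units (padic_ints p)"
proof -
  have p: "p > 0" using assms(1) by (rule prime_gt_0_nat)
  interpret cring "padic_ints p" by (rule cring_padic_ints[OF p])
  have cop: "coprime (int n) (int p ^ i)" for i
    using prime_imp_coprime[OF assms] by (simp add: coprime_commute)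
  then have "\<exists>y. [int n * y = 1] (mod int p ^ i)" for i
    by (simp add: cong_solve_coprime_int)
  then obtain y where y: "\<And>i. [int n * y i = 1] (mod int p ^ i)" by metis
  have "[y (Suc i) = y i] (mod int p ^ i)" for i
  proof -
    have "[int n * y (Suc i) = 1] (mod int p ^ i)"
      using y[of "Suc i"] by (rule cong_dvd_modulus) simp
    then have "[int n * y (Suc i) = int n * y i] (mod int p ^ i)"
      using y[of i] by (metis cong_sym cong_trans)
    then show ?thesis using cop by (simp add: cong_mult_lcancel)
  qed
  then have "(\<lambda>i. y i mod int p ^ i) \<in> carrier (padic_ints p)"
    by (rule padic_ints_carrierI[OF p])
  moreover have "([n] \<cdot>\<^bsub>padic_ints p\<^esub> \<one>\<^bsub>padic_ints p\<^esub>) \<otimes>\<^bsub>padic_ints p\<^esub> (\<lambda>i. y i mod int p ^ i)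
      = \<one>\<^bsub>padic_ints p\<^esub>"
    unfolding padic_ints_of_nat using y by (auto simp: padic_ints_def mod_simps cong_def)
  moreover have "[n] \<cdot>\<^bsub>padic_ints p\<^esub> \<one>\<^bsub>padic_ints p\<^esub> \<in> carrier (padic_ints p)"
    by simp
  ultimately show ?thesis
    by (auto simp: Units_def m_comm intro!: bexI)
qed

end

theory Submission
  imports Defs "HOL-Computational_Algebra.Polynomial_Factorial"
begin

text \<open>
  Let \<open>L\<close> be the linear map with \<open>L(t ^ k) = B\<^sub>k(x)\<close>. It sends the falling factorial
  \<open>(t)\<^sub>k\<close> to \<open>x ^ k\<close>, and \<open>L((t)\<^sub>n f(t)) = x ^ n L(f(t + n))\<close>. Put \<open>q = p ^ a\<close>. Modulo \<open>p\<close>,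
  the geometric sum of \<open>(- t / n) ^ k\<close> over \<open>k < q\<close> is \<open>(t + n) ^ (q - 1)\<close>, so \<open>x ^ n\<close> times its
  image is \<open>L((t)\<^sub>n t ^ (q - 1)) = L(t ^ q h)\<close> with \<open>h = (t - 1) \<cdots> (t - n + 1)\<close>.
  Since \<open>t ^ p - t\<close> is congruent to \<open>(t)\<^sub>p\<close>, multiplying by it inside \<open>L\<close> amounts to multiplying
  by \<open>x ^ p\<close> outside; with \<open>t ^ q = t + \<Sum>\<^bsub>r < a\<^esub> (t ^ p - t) ^ (p ^ r)\<close> this gives
  \<open>L(t ^ q h) = x ^ n + \<Sum>\<^bsub>1 \<le> r \<le> a\<^esub> x ^ (p ^ r) L(h)\<close>, and \<open>L(h)\<close> is computed from
  \<open>(t - 1)\<^sub>m = (t)\<^sub>m - m (t - 1)\<^sub>m\<^sub>-\<^sub>1\<close>.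
\<close>


subsection \<open>Congruences in commutative rings\<close>

text \<open>Congruence modulo a principal ideal; \<open>cong\<close> needs a Euclidean ring,
  which integer polynomials are not.\<close>

definition pcong :: "'a::comm_ring_1 \<Rightarrow> 'a \<Rightarrow> 'a \<Rightarrow> bool" where
  "pcong d a b \<longleftrightarrow> d dvd a - b"

lemma pcong_refl [simp, intro]: "pcong d a a"
  by (simp add: pcong_def)

lemma pcong_sym: "pcong d a b \<Longrightarrow> pcong d b a"
  unfolding pcong_def using dvd_minus_iff[of d "a - b"] by simp

lemma pcong_trans [trans]: "pcong d a b \<Longrightarrow> pcong d b c \<Longrightarrow> pcong d a c"
  unfolding pcong_def using dvd_add[of d "a - b" "b - c"] by simp

lemma pcong_add: "pcong d a b \<Longrightarrow> pcong d a' b' \<Longrightarrow> pcong d (a + a') (b + b')"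
  unfolding pcong_def using dvd_add[of d "a - b" "a' - b'"] by (simp add: algebra_simps)

lemma pcong_diff: "pcong d a b \<Longrightarrow> pcong d a' b' \<Longrightarrow> pcong d (a - a') (b - b')"
  unfolding pcong_def using dvd_diff[of d "a - b" "a' - b'"] by (simp add: algebra_simps)

lemma pcong_mult: "pcong d a b \<Longrightarrow> pcong d a' b' \<Longrightarrow> pcong d (a * a') (b * b')"
  unfolding pcong_def
  using dvd_add[OF dvd_mult2[of d "a - b" a'] dvd_mult[of d "a' - b'" b]]
  by (simp add: algebra_simps)

lemma pcong_power: "pcong d a b \<Longrightarrow> pcong d (a ^ k) (b ^ k)"
  by (induction k) (auto intro: pcong_mult)

lemma pcong_sum: "(\<And>i. i \<in> A \<Longrightarrow> pcong d (f i) (g i)) \<Longrightarrow> pcong d (sum f A) (sum g A)"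
  by (induction A rule: infinite_finite_induct) (auto intro: pcong_add)

lemma pcong_freshmans_dream:
  fixes a b :: "'a::comm_ring_1"
  assumes p: "prime p"
  shows "pcong (of_nat p) ((a + b) ^ p) (a ^ p + b ^ p)"
proof -
  have split: "{..p} = insert 0 (insert p {0<..<p})"
    using prime_gt_0_nat[OF p] by auto
  have "(a + b) ^ p - (a ^ p + b ^ p) =
      (\<Sum>k\<in>{0<..<p}. of_nat (p choose k) * a ^ k * b ^ (p - k))"
    unfolding binomial_ring split using prime_gt_0_nat[OF p] by simp
  also have "of_nat p dvd \<dots>"
  proof (intro dvd_sum dvd_mult2)
    fix k assume "k \<in> {0<..<p}"
    then have "p dvd p choose k" using p by (intro dvd_choose_prime) auto
    then show "of_nat p dvd (of_nat (p choose k) :: 'a)" by (auto elim!: dvdE)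
  qed
  finally show ?thesis by (simp add: pcong_def)
qed

lemma pcong_freshmans_dream':
  fixes a b :: "'a::comm_ring_1"
  assumes p: "prime p"
  shows "pcong (of_nat p) ((a + b) ^ p ^ r) (a ^ p ^ r + b ^ p ^ r)"
proof (induction r)
  case (Suc r)
  have "(a + b) ^ p ^ Suc r = ((a + b) ^ p ^ r) ^ p"
    by (simp add: mult.commute flip: power_mult)
  also have "pcong (of_nat p) \<dots> ((a ^ p ^ r + b ^ p ^ r) ^ p)"
    by (intro pcong_power Suc.IH)
  also have "pcong (of_nat p) \<dots> ((a ^ p ^ r) ^ p + (b ^ p ^ r) ^ p)"
    by (rule pcong_freshmans_dream[OF p])
  also have "\<dots> = a ^ p ^ Suc r + b ^ p ^ Suc r"
    by (simp add: mult.commute flip: power_mult)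
  finally show ?case .
qed simp

text \<open>Induction on \<open>n\<close> through the additivity of Frobenius. The ring is left
  general because the result serves both for integer values and for constants in
  \<open>int poly\<close>.\<close>

lemma pcong_fermat:
  assumes p: "prime p"
  shows "pcong (of_nat p) (of_nat n ^ p ^ r) (of_nat n :: 'a::comm_ring_1)"
proof (induction n)
  case 0
  then show ?case using prime_gt_0_nat[OF p] by (simp add: power_0_left)
next
  case (Suc n)
  have "pcong (of_nat p) ((1 + of_nat n) ^ p ^ r) (1 ^ p ^ r + of_nat n ^ p ^ r :: 'a)"
    by (rule pcong_freshmans_dream'[OF p])
  also have "pcong (of_nat p) \<dots> (1 + of_nat n)"
    by (intro pcong_add) (simp_all add: Suc.IH)
  finally show ?case by simp
qed

lemma pcong_poly_iff:
  "pcong (of_nat p) f g \<longleftrightarrow> (\<forall>k. [coeff f k = poly.coeff g k] (mod int p))"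
  for f g :: "int poly"
  by (simp add: pcong_def of_nat_poly const_poly_dvd_iff cong_iff_dvd_diff)

subsection \<open>The falling factorial modulo a prime\<close>

text \<open>Over the field with \<open>p\<close> elements a polynomial with more roots than its
  degree vanishes. Each step splits off the root \<open>n\<close>; the quotient keeps the roots
  \<open>i < n\<close>, since \<open>i - n\<close> is invertible modulo \<open>p\<close>.\<close>

lemma int_poly_dvd_of_values:
  fixes f :: "int poly"
  assumes p: "prime p" and "n \<le> p" and "degree f < n"
    and "\<And>i. i < n \<Longrightarrow> int p dvd poly f (int i)"
  shows "of_nat p dvd f"
  using assms(2-)
proof (induction n arbitrary: f)
  case (Suc n)
  define h where "h = synthetic_div f (int n)"
  have f: "f = [:- int n, 1:] * h + [:poly f (int n):]"
    unfolding h_def by (rule synthetic_div_correct'[symmetric])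
  have const: "of_nat p dvd [:poly f (int n):]"
    using Suc.prems(3)[of n] by (simp add: of_nat_poly const_poly_dvd_const_poly_iff)
  have "of_nat p dvd h"
  \<comment> \<open>For constant \<open>f\<close> the bound \<open>degree h < n\<close> fails when
    \<open>n = 0\<close>, but then the quotient itself is zero.\<close>
  proof (cases "degree f = 0")
    case True
    then have "h = 0" by (simp only: h_def synthetic_div_eq_0_iff)
    then show ?thesis by simp
  next
    case False
    show ?thesis
    proof (rule Suc.IH)
      show "degree h < n" using Suc.prems False by (simp add: h_def degree_synthetic_div)
      fix i assume i: "i < n"
      have "poly f (int i) = (int i - int n) * poly h (int i) + poly f (int n)"
        by (subst f) (simp add: algebra_simps)
      then have "int p dvd (int i - int n) * poly h (int i)"
        using Suc.prems(3)[of n] Suc.prems(3)[of i] i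
        by (metis dvd_add_left_iff lessI less_SucI)
      moreover have "\<not> int p dvd int i - int n"
        using i Suc.prems(1) zdvd_not_zless[of "int n - int i" "int p"]
        by (simp add: dvd_diff_commute)
      ultimately show "int p dvd poly h (int i)"
        using p by (simp add: prime_dvd_mult_iff)
    qed (use Suc.prems in auto)
  qed
  then show ?case using f const by (metis dvd_add dvd_mult)
qed simp

definition ffact_poly :: "nat \<Rightarrow> int poly" where
  "ffact_poly n = (\<Prod>i<n. [:- int i, 1:])"

lemma ffact_poly_0 [simp]: "ffact_poly 0 = 1"
  and ffact_poly_Suc: "ffact_poly (Suc n) = ffact_poly n * [:- int n, 1:]"
  by (simp_all add: ffact_poly_def)

text \<open>Splits off the first factor \<open>t\<close> instead of the last one, which is the form
  that the rule for \<open>t\<close> under \<open>umbra\<close> can consume.\<close>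

lemma ffact_poly_Suc_shift:
  "ffact_poly (Suc n) = [:0, 1:] * pcompose (ffact_poly n) [:-1, 1:]"
  unfolding ffact_poly_def by (subst prod.lessThan_Suc_shift)
    (simp add: pcompose_prod pcompose_pCons one_pCons algebra_simps)

lemma monic_ffact_poly: "degree (ffact_poly n) = n" "lead_coeff (ffact_poly n) = 1"
proof -
  show "degree (ffact_poly n) = n"
    unfolding ffact_poly_def by (subst degree_prod_sum_eq) simp_all
  show "lead_coeff (ffact_poly n) = 1"
    unfolding ffact_poly_def lead_coeff_prod by simp
qed

text \<open>Both sides are monic of degree \<open>p\<close> and vanish at all residues modulo \<open>p\<close>.\<close>

lemma ffact_poly_prime:
  assumes p: "prime p"
  shows "pcong (of_nat p) (ffact_poly p) ([:0, 1:] ^ p - [:0, 1:])"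
proof -
  define f where "f = ffact_poly p - ([:0, 1:] ^ p - [:0, 1:])"
  have p1: "p > 1" using p by (rule prime_gt_1_nat)
  have monom: "[:0, 1:] ^ p = (Polynomial.monom 1 p :: int poly)"
    by (simp add: monom_altdef)
  have "poly.coeff f k = 0" if "k \<ge> p" for k
    using that p1 monic_ffact_poly[of p]
    by (cases "k = p") (auto simp: f_def monom coeff_eq_0 coeff_pCons split: nat.splits)
  then have "degree f < p"
    using p1 by (metis degree_0 leading_coeff_0_iff not_less order_less_trans zero_less_one)
  moreover have "int p dvd poly f (int i)" if "i < p" for i
  proof -
    have "poly (ffact_poly p) (int i) = 0"
      using that by (auto simp: ffact_poly_def poly_prod)
    moreover have "int p dvd int i ^ p - int i"
      using pcong_fermat[OF p, of i 1, where 'a=int] by (simp add: pcong_def)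
    ultimately show ?thesis
      by (simp add: f_def poly_power dvd_diff_commute)
  qed
  ultimately have "of_nat p dvd f"
    by (intro int_poly_dvd_of_values[OF p order_refl])
  then show ?thesis by (simp add: pcong_def f_def)
qed

subsection \<open>The Bell umbra\<close>

text \<open>The Euler operator \<open>x d/dx\<close> conjugated by \<open>e^x\<close>: applied to
  \<open>g\<close> it gives \<open>e^(-x) x (e^x g)'\<close>.\<close>

definition bell_op :: "int poly \<Rightarrow> int poly" where
  "bell_op g = [:0, 1:] * (g + pderiv g)"

lemma bell_op_0 [simp]: "bell_op 0 = 0"
  and bell_op_add: "bell_op (f + g) = bell_op f + bell_op g"
  and bell_op_smult: "bell_op (Polynomial.smult c g) = Polynomial.smult c (bell_op g)"
  and bell_op_const: "bell_op [:c:] = [:0, c:]"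
  by (simp_all add: bell_op_def pderiv_add pderiv_smult pderiv_pCons algebra_simps
      smult_add_right)

text \<open>The commutation relation \<open>T x = x (T + 1)\<close>, the source of all shifts of
  \<open>t\<close> below.\<close>

lemma bell_op_X_mult: "bell_op ([:0, 1:] * g) = [:0, 1:] * (bell_op g + g)"
  by (simp add: bell_op_def pderiv_mult pderiv_pCons algebra_simps del: mult_pCons_left)

text \<open>The linear map with \<open>t ^ k \<mapsto> B\<^sub>k(x)\<close>, given by \<open>f \<mapsto> f(T) 1\<close> for
  the operator \<open>T = x (1 + d/dx)\<close> that raises Bell polynomials.\<close>

definition umbra :: "int poly \<Rightarrow> int poly" where
  "umbra f = fold_coeffs (\<lambda>a g. [:a:] + bell_op g) f 0"

lemma umbra_0 [simp]: "umbra 0 = 0"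
  by (simp add: umbra_def)

lemma umbra_pCons: "umbra (pCons a f) = [:a:] + bell_op (umbra f)"
  by (cases "pCons a f = 0") (auto simp: umbra_def)

lemma umbra_add: "umbra (f + g) = umbra f + umbra g"
  by (induction f g rule: poly_induct2) (simp_all add: umbra_pCons bell_op_add)

lemma umbra_smult: "umbra (Polynomial.smult c f) = Polynomial.smult c (umbra f)"
  by (induction f) (simp_all add: umbra_pCons bell_op_smult smult_add_right)

lemma umbra_diff: "umbra (f - g) = umbra f - umbra g"
  using umbra_add[of "f - g" g] by simp

lemma umbra_sum: "umbra (sum f A) = (\<Sum>i\<in>A. umbra (f i))"
  by (induction A rule: infinite_finite_induct) (simp_all add: umbra_add)

lemma umbra_of_nat_mult: "umbra (of_nat c * f) = of_nat c * umbra f"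
  by (simp add: of_nat_poly umbra_smult)

text \<open>By linearity multiples of \<open>p\<close> go to multiples of \<open>p\<close>, so
  congruences in \<open>t\<close> may be applied inside \<open>umbra\<close>.\<close>

lemma umbra_pcong: "pcong (of_nat p) f g \<Longrightarrow> pcong (of_nat p) (umbra f) (umbra g)"
  by (auto simp: pcong_def umbra_of_nat_mult simp flip: umbra_diff elim!: dvdE)

definition int_bell :: "nat \<Rightarrow> int poly" where
  "int_bell m = (\<Sum>k\<le>m. Polynomial.monom (int (Stirling m k)) k)"

lemma coeff_int_bell: "poly.coeff (int_bell m) k = int (Stirling m k)"
  by (cases "k \<le> m") (auto simp: int_bell_def coeff_sum)

text \<open>On coefficients this is \<open>S(m+1,k) = S(m,k-1) + k S(m,k)\<close>; the derivative
  supplies the factor \<open>k\<close>.\<close>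

lemma int_bell_Suc: "int_bell (Suc m) = bell_op (int_bell m)"
proof (rule poly_eqI)
  fix k show "poly.coeff (int_bell (Suc m)) k = poly.coeff (bell_op (int_bell m)) k"
    by (cases k) (simp_all add: coeff_int_bell bell_op_def coeff_pderiv algebra_simps)
qed

lemma umbra_X_power: "umbra ([:0, 1:] ^ k) = int_bell k"
proof (induction k)
  case 0
  show ?case by (simp add: umbra_pCons one_pCons int_bell_def monom_0)
next
  case (Suc k)
  then show ?case by (simp add: umbra_pCons int_bell_Suc)
qed

text \<open>Since \<open>T 1 = x\<close>, the left side is \<open>f(T) x\<close>; moving
  \<open>x\<close> to the left past every \<open>T\<close> turns this into
  \<open>x f(T + 1) 1\<close>.\<close>

lemma umbra_X_mult: "umbra ([:0, 1:] * f) = [:0, 1:] * umbra (pcompose f [:1, 1:])"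
proof (induction f)
  case (pCons a f)
  have "umbra (pcompose (pCons a f) [:1, 1:]) =
     [:a:] + bell_op (umbra (pcompose f [:1, 1:])) + umbra (pcompose f [:1, 1:])"
    by (simp add: pcompose_pCons umbra_add umbra_pCons)
  then have "[:0, 1:] * umbra (pcompose (pCons a f) [:1, 1:]) =
      [:0, a:] + bell_op ([:0, 1:] * umbra (pcompose f [:1, 1:]))"
    unfolding bell_op_X_mult by (simp add: algebra_simps)
  also have "\<dots> = umbra ([:0, 1:] * pCons a f)"
    unfolding pCons.IH[symmetric] by (simp add: umbra_pCons bell_op_add bell_op_const)
  finally show ?case ..
qed simp

text \<open>Each factor pulled out contributes one \<open>x\<close> and shifts what remains by 1;
  the shift brings the remaining factors back to a falling factorial and accumulates to
  \<open>n\<close> on \<open>f\<close>.\<close>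

lemma umbra_ffact_mult:
  "umbra (ffact_poly n * f) = [:0, 1:] ^ n * umbra (pcompose f [:int n, 1:])"
proof (induction n arbitrary: f)
  case 0
  then show ?case by simp
next
  case (Suc n)
  have "umbra (ffact_poly (Suc n) * f) =
      umbra ([:0, 1:] * (pcompose (ffact_poly n) [:-1, 1:] * f))"
    by (simp add: ffact_poly_Suc_shift mult.assoc del: mult_pCons_left)
  also have "\<dots> = [:0, 1:] * umbra (ffact_poly n * pcompose f [:1, 1:])"
    unfolding umbra_X_mult pcompose_mult
    by (simp add: pcompose_pCons flip: pcompose_assoc)
  also have "\<dots> = [:0, 1:] ^ Suc n * umbra (pcompose f [:int (Suc n), 1:])"
    unfolding Suc.IH
    by (simp add: pcompose_pCons flip: pcompose_assoc)
  finally show ?case .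
qed

lemma umbra_ffact: "umbra (ffact_poly n) = [:0, 1:] ^ n"
  using umbra_ffact_mult[of n 1] by (simp add: pcompose_1 one_pCons umbra_pCons)

section \<open>Multiplication by \<open>t ^ p - t\<close> and by \<open>t ^ p ^ a\<close> under the
  umbra\<close>

text \<open>Makes the shift produced by \<open>umbra_ffact_mult\<close> at \<open>n = p\<close>
  invisible modulo \<open>p\<close>.\<close>

lemma pcompose_shift_pcong: "pcong (of_nat p) (pcompose f [:int p, 1:]) f"
proof (induction f)
  case (pCons a f)
  have "pcong (of_nat p) [:int p, 1:] ([:0, 1:] :: int poly)"
    by (simp add: pcong_def of_nat_poly)
  then have "pcong (of_nat p) ([:a:] + [:int p, 1:] * pcompose f [:int p, 1:]) ([:a:] + [:0, 1:] * f)"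
    by (intro pcong_add pcong_mult pCons.IH) simp_all
  then show ?case by (simp add: pcompose_pCons)
qed simp

text \<open>Each factor \<open>t ^ p - t\<close> is exchanged for \<open>ffact_poly p\<close>, which
  leaves \<open>umbra\<close> as \<open>x ^ p\<close> at the cost of a harmless shift by
  \<open>p\<close>.\<close>

lemma umbra_Artin_Schreier_mult:
  assumes p: "prime p"
  shows "pcong (of_nat p) (umbra (([:0, 1:] ^ p - [:0, 1:]) ^ k * f)) ([:0, 1:] ^ (p * k) * umbra f)"
proof (induction k arbitrary: f)
  case (Suc k)
  let ?w = "[:0, 1:] ^ p - [:0, 1:] :: int poly"
  have "?w ^ Suc k * f = ?w ^ k * (?w * f)" by (simp add: algebra_simps del: mult_pCons_left)
  then have "pcong (of_nat p) (umbra (?w ^ Suc k * f)) ([:0, 1:] ^ (p * k) * umbra (?w * f))"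
    using Suc.IH by metis
  also have "pcong (of_nat p) \<dots> ([:0, 1:] ^ (p * k) * umbra (ffact_poly p * f))"
    by (intro pcong_mult umbra_pcong pcong_sym[OF ffact_poly_prime[OF p]]) auto
  also have "pcong (of_nat p) \<dots> ([:0, 1:] ^ (p * k) * ([:0, 1:] ^ p * umbra f))"
    unfolding umbra_ffact_mult
    by (intro pcong_mult umbra_pcong pcompose_shift_pcong) auto
  also have "\<dots> = [:0, 1:] ^ (p * Suc k) * umbra f"
    by (simp add: power_add mult.assoc algebra_simps)
  finally show ?case .
qed simp

text \<open>A telescoping sum: by Frobenius, \<open>t ^ p ^ (r + 1) - t ^ p ^ r\<close> is congruent
  to \<open>(t ^ p - t) ^ p ^ r\<close>.\<close>

lemma X_power_prime_power:
  assumes p: "prime p"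
  shows "pcong (of_nat p) ([:0, 1:] ^ p ^ a :: int poly)
    ([:0, 1:] + (\<Sum>r<a. ([:0, 1:] ^ p - [:0, 1:]) ^ p ^ r))"
proof (induction a)
  case (Suc a)
  let ?w = "[:0, 1:] ^ p - [:0, 1:] :: int poly"
  have "[:0, 1:] ^ p ^ Suc a = ([:0, 1:] + ?w) ^ p ^ a"
    by (simp flip: power_mult)
  also have "pcong (of_nat p) \<dots> ([:0, 1:] ^ p ^ a + ?w ^ p ^ a)"
    by (rule pcong_freshmans_dream'[OF p])
  also have "pcong (of_nat p) \<dots> (([:0, 1:] + (\<Sum>r<a. ?w ^ p ^ r)) + ?w ^ p ^ a)"
    by (intro pcong_add Suc.IH pcong_refl)
  finally show ?case by (simp add: add.assoc)
qed simp

lemma umbra_X_power_prime_power_mult: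
  assumes p: "prime p"
  shows "pcong (of_nat p) (umbra ([:0, 1:] ^ p ^ a * f))
    (umbra ([:0, 1:] * f) + (\<Sum>r=1..a. [:0, 1:] ^ p ^ r) * umbra f)"
proof -
  let ?w = "[:0, 1:] ^ p - [:0, 1:] :: int poly"
  have "pcong (of_nat p) (umbra ([:0, 1:] ^ p ^ a * f))
      (umbra (([:0, 1:] + (\<Sum>r<a. ?w ^ p ^ r)) * f))"
    by (intro umbra_pcong pcong_mult X_power_prime_power[OF p] pcong_refl)
  also have "\<dots> = umbra ([:0, 1:] * f) + (\<Sum>r<a. umbra (?w ^ p ^ r * f))"
    by (simp only: distrib_right umbra_add sum_distrib_right umbra_sum)
  also have "pcong (of_nat p) \<dots>
      (umbra ([:0, 1:] * f) + (\<Sum>r<a. [:0, 1:] ^ (p * p ^ r) * umbra f))"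
    by (intro pcong_add pcong_sum umbra_Artin_Schreier_mult[OF p] pcong_refl)
  also have "(\<Sum>r<a. [:0, 1:] ^ (p * p ^ r) * umbra f) = (\<Sum>r=1..a. [:0, 1:] ^ p ^ r) * umbra f"
    by (simp add: sum_distrib_right sum.atLeast1_atMost_eq)
  finally show ?thesis .
qed

text \<open>With \<open>h_n = (t - 1)_n\<close>, the last factor \<open>t - (n + 1)\<close> of
  \<open>h_(n+1)\<close> gives \<open>h_(n+1) = (t)_(n+1) - (n + 1) h_n\<close>. Under
  \<open>umbra\<close> this is a recurrence, and the sign \<open>(-1) ^ n\<close> turns its
  subtraction into addition.\<close>

lemma umbra_shifted_ffact:
  "(-1) ^ n * umbra (pcompose (ffact_poly n) [:-1, 1:]) =
    (\<Sum>k=0..n. of_nat (fact n div fact k) * (- [:0, 1:]) ^ k)"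
proof (induction n)
  case 0
  show ?case by (simp add: umbra_pCons one_pCons pcompose_1)
next
  case (Suc n)
  let ?h = "\<lambda>n. pcompose (ffact_poly n) [:-1, 1:]"
  have "?h (Suc n) = ?h n * [:- int (Suc n), 1:]"
    unfolding ffact_poly_Suc pcompose_mult by (simp add: pcompose_pCons algebra_simps)
  also have "\<dots> = ffact_poly (Suc n) - of_nat (Suc n) * ?h n"
    by (simp add: ffact_poly_Suc_shift of_nat_poly del: of_nat_Suc)
  finally have "umbra (?h (Suc n)) = [:0, 1:] ^ Suc n - of_nat (Suc n) * umbra (?h n)"
    by (simp only: umbra_diff umbra_ffact umbra_of_nat_mult)
  then have "(-1) ^ Suc n * umbra (?h (Suc n)) =
      (- [:0, 1:]) ^ Suc n + of_nat (Suc n) * ((-1) ^ n * umbra (?h n))"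
    by (simp only: power_minus[of "[:0, 1:]"]) (simp add: algebra_simps del: mult_pCons_left of_nat_Suc)
  also have "\<dots> = (- [:0, 1:]) ^ Suc n +
      (\<Sum>k=0..n. of_nat (fact (Suc n) div fact k) * (- [:0, 1:]) ^ k)"
    unfolding Suc.IH sum_distrib_left
  proof (intro arg_cong2[where f = "(+)"] refl sum.cong)
    fix k assume "k \<in> {0..n}"
    \<comment> \<open>The division is exact because \<open>k\<close> is at most \<open>n\<close>, so
      the factor \<open>Suc n\<close> can be moved inside.\<close>
    then have "fact (Suc n) div fact k = Suc n * (fact n div fact k)"
      using div_mult_swap[OF fact_dvd[of k n, where 'a=nat], of "Suc n"] by simp
    then show "of_nat (Suc n) * (of_nat (fact n div fact k) * (- [:0, 1:]) ^ k) =
        of_nat (fact (Suc n) div fact k) * (- [:0, 1:] :: int poly) ^ k"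
      by (simp only: of_nat_mult mult.assoc)
  qed
  finally show ?case by (simp add: algebra_simps del: mult_pCons_left power_Suc)
qed

section \<open>The geometric sum and the congruence over the integers\<close>

lemma pcompose_X_power: "pcompose ([:0, 1:] ^ k) q = q ^ k" for q :: "'a::comm_ring_1 poly"
  by (induction k) (simp_all add: pcompose_1 pcompose_pCons)

text \<open>With \<open>c = - m t\<close>, \<open>t + n\<close> is congruent to
  \<open>n (1 - c)\<close>. Multiplying the sum by it gives \<open>n (1 - c ^ q)\<close> for
  \<open>q = p ^ a\<close>, which Fermat and Frobenius turn into \<open>(t + n) ^ q\<close>; then
  \<open>t + n\<close> is cancelled.\<close>

lemma geometric_sum_pcong:
  assumes p: "prime p" and mn: "[int n * m = 1] (mod int p)"
  shows "pcong (of_nat p) (\<Sum>k<p ^ a. [:0, - m:] ^ k) ([:int n, 1:] ^ (p ^ a - 1))"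
proof -
  let ?c = "[:0, - m:]"
  let ?S = "\<Sum>k<p ^ a. ?c ^ k"
  have q: "p ^ a > 0" using prime_gt_0_nat[OF p] by simp
  have base: "pcong (of_nat p) [:int n, 1:] (of_nat n * (1 - ?c))"
    unfolding pcong_poly_iff
    using mn by (auto simp: of_nat_poly coeff_pCons cong_sym split: nat.splits)
  \<comment> \<open>Frobenius applied to \<open>1 = (1 - c) + c\<close> avoids the sign of
    \<open>(- c) ^ p ^ a\<close>, which depends on the parity of \<open>p\<close>.\<close>
  have "pcong (of_nat p) (((1 - ?c) + ?c) ^ p ^ a) ((1 - ?c) ^ p ^ a + ?c ^ p ^ a)"
    by (rule pcong_freshmans_dream'[OF p])
  then have "pcong (of_nat p) (1 - ?c ^ p ^ a) ((1 - ?c) ^ p ^ a + ?c ^ p ^ a - ?c ^ p ^ a)"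
    by (intro pcong_diff) auto
  then have frob: "pcong (of_nat p) (1 - ?c ^ p ^ a) ((1 - ?c) ^ p ^ a)"
    by simp
  have "pcong (of_nat p) ([:int n, 1:] * ?S) (of_nat n * (1 - ?c) * ?S)"
    by (intro pcong_mult base pcong_refl)
  also have "\<dots> = of_nat n * (1 - ?c ^ p ^ a)"
    by (simp only: mult.assoc one_diff_power_eq)
  also have "pcong (of_nat p) \<dots> (of_nat n ^ p ^ a * (1 - ?c) ^ p ^ a)"
    by (intro pcong_mult frob pcong_sym[OF pcong_fermat[OF p]])
  also have "\<dots> = (of_nat n * (1 - ?c)) ^ p ^ a"
    by (simp only: power_mult_distrib)
  also have "pcong (of_nat p) \<dots> ([:int n, 1:] ^ p ^ a)"
    by (intro pcong_power pcong_sym[OF base])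
  also have "\<dots> = [:int n, 1:] * [:int n, 1:] ^ (p ^ a - 1)"
    by (simp only: mult.commute[of "[:int n, 1:]"] power_minus_mult[OF q])
  finally have "of_nat p dvd [:int n, 1:] * (?S - [:int n, 1:] ^ (p ^ a - 1))"
    unfolding pcong_def right_diff_distrib .
  \<comment> \<open>Cancellation is legitimate: \<open>p\<close> stays prime in
    \<open>int poly\<close> and does not divide \<open>t + n\<close>, whose leading coefficient is
    1.\<close>
  moreover have "prime_elem (of_nat p :: int poly)"
    unfolding of_nat_poly using p by (intro lift_prime_elem_poly) simp
  moreover have "\<not> of_nat p dvd [:int n, 1:]"
    using prime_gt_1_nat[OF p]
    by (auto simp: of_nat_poly const_poly_dvd_iff coeff_pCons split: nat.splits intro!: exI[of _ 1])
  ultimately show ?thesis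
    by (simp add: prime_elem_dvd_mult_iff pcong_def del: mult_pCons_left)
qed

text \<open>The integer form of the theorem: \<open>m\<close>, an inverse of \<open>n\<close> modulo
  \<open>p\<close>, stands in for \<open>1 / n\<close>.\<close>

lemma int_bell_sum_pcong:
  assumes p: "prime p" and n: "n > 0" and mn: "[int n * m = 1] (mod int p)"
  shows "pcong (of_nat p)
    ((- [:0, 1:]) ^ n * (\<Sum>k=1..p ^ a - 1. Polynomial.smult ((- m) ^ k) (int_bell k)))
    (- (\<Sum>r=1..a. [:0, 1:] ^ p ^ r *
      (\<Sum>k=0..n - 1. of_nat (fact (n - 1) div fact k) * (- [:0, 1:]) ^ k)))"
proof -
  let ?X = "[:0, 1:] :: int poly"
  obtain n' where n': "n = Suc n'" using n by (cases n) auto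
  define h where "h = pcompose (ffact_poly n') [:-1, 1:]"
  define E where "E = (\<Sum>r=1..a. ?X ^ p ^ r)"
  have q: "p ^ a > 0" using prime_gt_0_nat[OF p] by simp
  have ff: "ffact_poly n = ?X * h"
    unfolding n' h_def by (rule ffact_poly_Suc_shift)
  have umbral: "Polynomial.smult ((- m) ^ k) (int_bell k) = umbra ([:0, - m:] ^ k)" for k
  proof -
    have "[:0, - m:] ^ k = Polynomial.smult ((- m) ^ k) (?X ^ k)"
      by (simp flip: smult_power)
    then show ?thesis by (simp only: umbra_smult umbra_X_power)
  qed
  \<comment> \<open>The geometric sum has an extra term \<open>B_0 = 1\<close> at
    \<open>k = 0\<close>. Its contribution \<open>x ^ n\<close> will cancel against
    \<open>umbra (t h) = umbra ((t)_n) = x ^ n\<close>.\<close>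
  have "{..<p ^ a} = insert 0 {1..p ^ a - 1}" using q by auto
  then have sum: "(\<Sum>k=1..p ^ a - 1. Polynomial.smult ((- m) ^ k) (int_bell k)) =
      umbra (\<Sum>k<p ^ a. [:0, - m:] ^ k) - 1"
    by (simp add: umbral umbra_sum umbra_add umbra_pCons one_pCons)
  have shift: "pcompose (?X ^ (p ^ a - 1)) [:int n, 1:] = [:int n, 1:] ^ (p ^ a - 1)"
    by (rule pcompose_X_power)
  have "pcong (of_nat p) (?X ^ n * umbra (\<Sum>k<p ^ a. [:0, - m:] ^ k))
      (?X ^ n * umbra ([:int n, 1:] ^ (p ^ a - 1)))"
    by (intro pcong_mult umbra_pcong geometric_sum_pcong[OF p mn] pcong_refl)
  also have "\<dots> = umbra (ffact_poly n * ?X ^ (p ^ a - 1))"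
    by (simp only: umbra_ffact_mult shift)
  \<comment> \<open>The factor \<open>t\<close> in \<open>(t)_n = t h\<close> completes the exponent
    \<open>p ^ a - 1\<close> to \<open>p ^ a\<close>.\<close>
  also have "ffact_poly n * ?X ^ (p ^ a - 1) = ?X ^ p ^ a * h"
    unfolding ff power_minus_mult[OF q, of ?X, symmetric] by (simp only: mult_ac)
  also have "pcong (of_nat p) (umbra \<dots>) (umbra (?X * h) + E * umbra h)"
    unfolding E_def by (rule umbra_X_power_prime_power_mult[OF p])
  also have "\<dots> = ?X ^ n + E * umbra h"
    by (simp only: umbra_ffact flip: ff)
  finally have "pcong (of_nat p) (?X ^ n * umbra (\<Sum>k<p ^ a. [:0, - m:] ^ k)) (?X ^ n + E * umbra h)" .
  then have "pcong (of_nat p) ((-1) ^ n * (?X ^ n * umbra (\<Sum>k<p ^ a. [:0, - m:] ^ k) - ?X ^ n))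
      ((-1) ^ n * (?X ^ n + E * umbra h - ?X ^ n))"
    by (intro pcong_mult pcong_diff pcong_refl)
  \<comment> \<open>As \<open>n = n' + 1\<close>, one factor \<open>-1\<close> is left over: the
    global minus sign of the right-hand side.\<close>
  also have "(-1) ^ n * (?X ^ n + E * umbra h - ?X ^ n) = - (E * ((-1) ^ n' * umbra h))"
    by (simp add: n' del: mult_pCons_left power_Suc) (simp add: algebra_simps)
  also have "\<dots> = - (\<Sum>r=1..a. ?X ^ p ^ r *
      (\<Sum>k=0..n - 1. of_nat (fact (n - 1) div fact k) * (- ?X) ^ k))"
    unfolding h_def umbra_shifted_ffact E_def by (simp add: n' sum_distrib_right del: mult_pCons_left)
  also have "(-1) ^ n * (?X ^ n * umbra (\<Sum>k<p ^ a. [:0, - m:] ^ k) - ?X ^ n) =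
      (- ?X) ^ n * (\<Sum>k=1..p ^ a - 1. Polynomial.smult ((- m) ^ k) (int_bell k))"
    unfolding sum power_minus[of ?X n] by (simp only: algebra_simps mult_1_right)
  finally show ?thesis .
qed


subsection \<open>Reduction of \<open>p\<close>-adic polynomials modulo \<open>p\<close>\<close>

text \<open>All residues of \<open>x\<close> are divisible by \<open>p\<close> because they agree
  with \<open>x 1\<close> modulo \<open>p\<close>. That zero is divided to zero is recorded so that
  coefficientwise division preserves finite support.\<close>

lemma padic_ints_multiple_of_p:
  assumes p: "prime p" and x: "x \<in> carrier (padic_ints p)" and x1: "x 1 = 0"
  obtains y where "y \<in> carrier (padic_ints p)" "x = [p] \<cdot>\<^bsub>padic_ints p\<^esub> y"
    "x = \<zero>\<^bsub>padic_ints p\<^esub> \<Longrightarrow> y = \<zero>\<^bsub>padic_ints p\<^esub>"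
proof
  have p0: "p > 0" using p by (rule prime_gt_0_nat)
  interpret cring "padic_ints p" by (rule cring_padic_ints[OF p0])
  \<comment> \<open>The index moves by one: \<open>x / p\<close> modulo \<open>p ^ i\<close> is
    determined by \<open>x\<close> modulo \<open>p ^ (i + 1)\<close>.\<close>
  define y where "y = (\<lambda>i. x (Suc i) div int p)"
  have step: "x (Suc i) mod int p ^ i = x i" for i
    using x by (simp add: padic_ints_def)
  have range: "0 \<le> x i" "x i < int p ^ i" for i
    using x by (auto simp: padic_ints_def)
  have dvd: "int p dvd x (Suc i)" for i
  proof (induction i)
    case 0
    then show ?case using x1 by simp
  next
    case (Suc i)
    have "int p dvd x (Suc (Suc i)) mod int p ^ Suc i" using Suc by (simp only: step)
    then show ?case by (subst (asm) dvd_mod_iff) auto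
  qed
  have py: "int p * y i = x (Suc i)" for i using dvd by (simp add: y_def)
  have yr: "0 \<le> y i \<and> y i < int p ^ i" for i
    using range[of "Suc i"] p0 by (simp add: py[symmetric] zero_le_mult_iff)
  have "y (Suc i) mod int p ^ i = y i" for i
  proof -
    have "int p * (y (Suc i) mod int p ^ i) = (int p * y (Suc i)) mod (int p * int p ^ i)"
      by (rule mult_mod_right)
    also have "\<dots> = int p * y i" using step[of "Suc i"] by (simp add: py)
    finally show ?thesis using p0 by simp
  qed
  with yr show y: "y \<in> carrier (padic_ints p)" by (simp add: padic_ints_def)
  have "[p] \<cdot>\<^bsub>padic_ints p\<^esub> y = ([p] \<cdot>\<^bsub>padic_ints p\<^esub> \<one>\<^bsub>padic_ints p\<^esub>) \<otimes>\<^bsub>padic_ints p\<^esub> y"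
    using y by (simp add: add_pow_ldistr)
  also have "\<dots> = x"
    unfolding padic_ints_of_nat
    by (auto simp: padic_ints_def mod_mult_left_eq py step)
  finally show "x = [p] \<cdot>\<^bsub>padic_ints p\<^esub> y" ..
  show "y = \<zero>\<^bsub>padic_ints p\<^esub>" if "x = \<zero>\<^bsub>padic_ints p\<^esub>"
    using that by (simp add: y_def padic_ints_def)
qed

locale padic_reduction =
  fixes p :: nat
  assumes prime_p: "prime p"
begin

abbreviation "R \<equiv> padic_ints p"
abbreviation "P \<equiv> padic_poly p"

sublocale R: cring R
  by (rule cring_padic_ints) (rule prime_gt_0_nat[OF prime_p])

sublocale UP_cring R P
  by unfold_locales simp

text \<open>Component \<open>1\<close> of a \<open>p\<close>-adic integer is its residue modulo \<open>p\<close>.\<close>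

definition lifts :: "(nat \<Rightarrow> nat \<Rightarrow> int) \<Rightarrow> int poly \<Rightarrow> bool" where
  "lifts f F \<longleftrightarrow> f \<in> carrier P \<and> (\<forall>k. [up_ring.coeff P f k 1 = poly.coeff F k] (mod int p))"

lemma residue_add: "[(x \<oplus>\<^bsub>R\<^esub> y) 1 = x 1 + y 1] (mod int p)"
  and residue_mult: "[(x \<otimes>\<^bsub>R\<^esub> y) 1 = x 1 * y 1] (mod int p)"
  and residue_zero: "\<zero>\<^bsub>R\<^esub> i = 0"
  and residue_one: "[\<one>\<^bsub>R\<^esub> 1 = 1] (mod int p)"
  by (simp_all add: padic_ints_def cong_def)

lemma residue_finsum:
  assumes "f \<in> A \<rightarrow> carrier R"
  shows "[finsum R f A 1 = (\<Sum>i\<in>A. f i 1)] (mod int p)"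
  using assms
proof (induction A rule: infinite_finite_induct)
  case (insert a A)
  then have "finsum R f (insert a A) = f a \<oplus>\<^bsub>R\<^esub> finsum R f A"
    by (intro R.finsum_insert) auto
  moreover have "[(f a \<oplus>\<^bsub>R\<^esub> finsum R f A) 1 = f a 1 + (\<Sum>i\<in>A. f i 1)] (mod int p)"
    using insert by (intro cong_trans[OF residue_add] cong_add) auto
  ultimately show ?case using insert by simp
qed (simp_all add: residue_zero R.finsum_infinite)

text \<open>\<open>padic_ints\<close> carries no formula for negation, so the residue is read off
  from \<open>x + (- x) = 0\<close>.\<close>

lemma residue_a_inv:
  assumes "x \<in> carrier R"
  shows "[(\<ominus>\<^bsub>R\<^esub> x) 1 = - x 1] (mod int p)"
proof -
  have "[0 = x 1 + (\<ominus>\<^bsub>R\<^esub> x) 1] (mod int p)"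
    using residue_add[of x "\<ominus>\<^bsub>R\<^esub> x"] assms by (simp add: R.r_neg residue_zero)
  then show ?thesis
    by (metis add.commute add.right_inverse cong_add_lcancel cong_sym)
qed

lemma residue_pow:
  assumes "x \<in> carrier R"
  shows "[(x [^]\<^bsub>R\<^esub> k) 1 = x 1 ^ k] (mod int p)"
proof (induction k)
  case (Suc k)
  have "[(x [^]\<^bsub>R\<^esub> k \<otimes>\<^bsub>R\<^esub> x) 1 = x 1 ^ k * x 1] (mod int p)"
    by (intro cong_trans[OF residue_mult] cong_mult Suc cong_refl)
  then show ?case by (simp add: mult.commute)
qed (simp add: residue_one[simplified])

section \<open>Compatibility of lifting with the polynomial operations\<close>

lemma lifts_carrier: "lifts f F \<Longrightarrow> f \<in> carrier P"
  by (simp add: lifts_def)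

lemma lifts_zero: "lifts \<zero>\<^bsub>P\<^esub> 0"
  by (simp add: lifts_def residue_zero)

lemma lifts_one: "lifts \<one>\<^bsub>P\<^esub> 1"
  by (simp add: lifts_def residue_zero residue_one[simplified] coeff_pCons one_pCons
      split: nat.splits)

lemma lifts_X: "lifts (poly_var R) [:0, 1:]"
  by (simp add: lifts_def residue_zero residue_one[simplified] coeff_pCons
      split: nat.splits)

lemma lifts_add: "lifts f F \<Longrightarrow> lifts g G \<Longrightarrow> lifts (f \<oplus>\<^bsub>P\<^esub> g) (F + G)"
  unfolding lifts_def by (auto intro!: cong_trans[OF residue_add] cong_add simp del: One_nat_def)

lemma lifts_a_inv: "lifts f F \<Longrightarrow> lifts (\<ominus>\<^bsub>P\<^esub> f) (- F)"
  unfolding lifts_def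
  by (auto intro!: cong_trans[OF residue_a_inv] simp: cong_minus_minus_iff simp del: One_nat_def)

lemma lifts_mult:
  assumes "lifts f F" "lifts g G"
  shows "lifts (f \<otimes>\<^bsub>P\<^esub> g) (F * G)"
proof -
  have fg: "f \<in> carrier P" "g \<in> carrier P" using assms by (auto simp: lifts_def)
  have "[up_ring.coeff P (f \<otimes>\<^bsub>P\<^esub> g) k 1 = poly.coeff (F * G) k] (mod int p)" for k
  proof -
    have coeff_fg: "up_ring.coeff P (f \<otimes>\<^bsub>P\<^esub> g) k =
        (\<Oplus>\<^bsub>R\<^esub>i\<in>{..k}. up_ring.coeff P f i \<otimes>\<^bsub>R\<^esub> up_ring.coeff P g (k - i))"
      using fg by (rule coeff_mult)
    have "[up_ring.coeff P (f \<otimes>\<^bsub>P\<^esub> g) k 1 = (\<Sum>i\<le>k. (up_ring.coeff P f i \<otimes>\<^bsub>R\<^esub> up_ring.coeff P g (k - i)) 1)] (mod int p)"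
      unfolding coeff_fg using fg by (intro residue_finsum) auto
    also have "[(\<Sum>i\<le>k. (up_ring.coeff P f i \<otimes>\<^bsub>R\<^esub> up_ring.coeff P g (k - i)) 1) =
        (\<Sum>i\<le>k. poly.coeff F i * poly.coeff G (k - i))] (mod int p)"
    proof (rule cong_sum)
      fix i
      have "[up_ring.coeff P f i 1 * up_ring.coeff P g (k - i) 1 =
          poly.coeff F i * poly.coeff G (k - i)] (mod int p)"
        using assms unfolding lifts_def by (blast intro: cong_mult)
      then show "[(up_ring.coeff P f i \<otimes>\<^bsub>R\<^esub> up_ring.coeff P g (k - i)) 1 =
          poly.coeff F i * poly.coeff G (k - i)] (mod int p)"
        by (rule cong_trans[OF residue_mult])
    qed
    finally show ?thesis by (simp add: Polynomial.coeff_mult)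
  qed
  then show ?thesis using fg by (simp add: lifts_def)
qed

lemma lifts_smult:
  assumes "c \<in> carrier R" "[c 1 = d] (mod int p)" "lifts f F"
  shows "lifts (c \<odot>\<^bsub>P\<^esub> f) (Polynomial.smult d F)"
proof -
  have f: "f \<in> carrier P" using assms(3) by (rule lifts_carrier)
  have "[(c \<otimes>\<^bsub>R\<^esub> up_ring.coeff P f k) 1 = d * poly.coeff F k] (mod int p)" for k
    using assms by (intro cong_trans[OF residue_mult cong_mult]) (auto simp: lifts_def)
  then show ?thesis using assms(1) f by (simp add: lifts_def)
qed

lemma lifts_pow: "lifts f F \<Longrightarrow> lifts (f [^]\<^bsub>P\<^esub> (k::nat)) (F ^ k)"
proof (induction k)
  case (Suc k)
  then have "lifts (f [^]\<^bsub>P\<^esub> k \<otimes>\<^bsub>P\<^esub> f) (F ^ k * F)" by (intro lifts_mult)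
  then show ?case by (simp add: mult.commute)
qed (simp add: lifts_one)

lemma lifts_add_pow: "lifts f F \<Longrightarrow> lifts ([(k::nat)] \<cdot>\<^bsub>P\<^esub> f) (of_nat k * F)"
proof (induction k)
  case (Suc k)
  then have "lifts ([k] \<cdot>\<^bsub>P\<^esub> f \<oplus>\<^bsub>P\<^esub> f) (of_nat k * F + F)" by (intro lifts_add)
  then show ?case by (simp add: algebra_simps)
qed (simp add: lifts_zero)

lemma lifts_finsum:
  assumes "\<And>i. i \<in> A \<Longrightarrow> lifts (f i) (F i)"
  shows "lifts (finsum P f A) (sum F A)"
  using assms
proof (induction A rule: infinite_finite_induct)
  case (insert a A)
  then have "finsum P f (insert a A) = f a \<oplus>\<^bsub>P\<^esub> finsum P f A"
    by (intro P.finsum_insert) (auto dest: lifts_carrier)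
  moreover have "lifts (f a \<oplus>\<^bsub>P\<^esub> finsum P f A) (F a + sum F A)"
    using insert by (intro lifts_add) auto
  ultimately show ?case using insert by simp
qed (simp_all add: lifts_zero P.finsum_infinite)

lemma lifts_bell_poly: "lifts (bell_poly R m) (int_bell m)"
proof -
  have "int_bell m = (\<Sum>k=0..m. of_nat (Stirling m k) * [:0, 1:] ^ k)"
    by (simp add: int_bell_def monom_altdef of_nat_poly atMost_atLeast0)
  then show ?thesis
    unfolding bell_poly_def
    by (simp only:) (intro lifts_finsum lifts_add_pow lifts_pow lifts_X)
qed

lemma residue_eq_0_iff: "x \<in> carrier R \<Longrightarrow> [x 1 = 0] (mod int p) \<longleftrightarrow> x 1 = 0"
  using padic_ints_carrier_cong(2)[of x p 1] by (simp add: cong_def)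

text \<open>Every coefficient has residue 0 and is therefore divisible by \<open>p\<close>. The
  quotients are chosen to be zero wherever the coefficient is, so they again form a
  polynomial.\<close>

lemma lifts_0_imp_multiple:
  assumes "lifts f F" "pcong (of_nat p) F 0"
  shows "\<exists>h\<in>carrier P. f = [p] \<cdot>\<^bsub>P\<^esub> h"
proof -
  have f: "f \<in> carrier P" using assms by (simp add: lifts_def)
  have "up_ring.coeff P f k 1 = 0" for k
  proof -
    have "[up_ring.coeff P f k 1 = 0] (mod int p)"
      using assms by (auto simp: lifts_def pcong_poly_iff intro: cong_trans simp del: One_nat_def)
    then show ?thesis using f by (simp add: residue_eq_0_iff del: One_nat_def)
  qed
  then have "\<exists>y. y \<in> carrier R \<and> up_ring.coeff P f k = [p] \<cdot>\<^bsub>R\<^esub> y \<and>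
      (up_ring.coeff P f k = \<zero>\<^bsub>R\<^esub> \<longrightarrow> y = \<zero>\<^bsub>R\<^esub>)" for k
    using f padic_ints_multiple_of_p[OF prime_p, of "up_ring.coeff P f k"] by (metis coeff_closed)
  then obtain h where h: "\<And>k. h k \<in> carrier R" "\<And>k. up_ring.coeff P f k = [p] \<cdot>\<^bsub>R\<^esub> h k"
      "\<And>k. up_ring.coeff P f k = \<zero>\<^bsub>R\<^esub> \<Longrightarrow> h k = \<zero>\<^bsub>R\<^esub>"
    by metis
  obtain N where "bound \<zero>\<^bsub>R\<^esub> N (up_ring.coeff P f)"
    using f by (auto simp: UP_def up_def)
  then have "bound \<zero>\<^bsub>R\<^esub> N h" using h(3) by (auto simp: bound_def)
  then have hup: "h \<in> carrier P" using h(1) by (auto simp: UP_def)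
  have coeff_h: "up_ring.coeff P h k = h k" for k using hup by (simp add: UP_def)
  have "up_ring.coeff P ([j] \<cdot>\<^bsub>P\<^esub> h) k = [j] \<cdot>\<^bsub>R\<^esub> h k" for j :: nat and k
    by (induction j) (use hup h(1) in \<open>simp_all add: coeff_h\<close>)
  then have "f = [p] \<cdot>\<^bsub>P\<^esub> h"
    using f hup h(2) by (intro up_eqI) auto
  with hup show ?thesis by blast
qed

text \<open>Transfers a congruence between integer polynomials to any of their lifts.\<close>

lemma padic_poly_congI:
  assumes "lifts f F" "lifts g G" "pcong (of_nat p) F G"
  shows "padic_poly_cong p f g"
proof -
  have "lifts (f \<ominus>\<^bsub>P\<^esub> g) (F - G)"
    using lifts_add[OF assms(1) lifts_a_inv[OF assms(2)]] by (simp add: a_minus_def)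
  moreover have "pcong (of_nat p) (F - G) 0"
    using assms(3) by (simp add: pcong_def)
  ultimately show ?thesis
    using lifts_0_imp_multiple assms(1,2) unfolding padic_poly_cong_def
    by (auto dest: lifts_carrier)
qed

text \<open>Identifies the residue of the scalar \<open>1 / (-n) ^ k\<close>, so that it lifts the
  integer \<open>(- m) ^ k\<close>.\<close>

lemma residue_inv_neg_power:
  fixes k :: nat
  assumes n: "\<not> p dvd n" and mn: "[int n * m = 1] (mod int p)"
  defines "u \<equiv> (\<ominus>\<^bsub>R\<^esub> ([n] \<cdot>\<^bsub>R\<^esub> \<one>\<^bsub>R\<^esub>)) [^]\<^bsub>R\<^esub> k"
  shows "inv\<^bsub>R\<^esub> u \<in> carrier R" and "[(inv\<^bsub>R\<^esub> u) 1 = (- m) ^ k] (mod int p)"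
proof -
  have N: "[n] \<cdot>\<^bsub>R\<^esub> \<one>\<^bsub>R\<^esub> \<in> Units R" (is "?N \<in> _") by (rule of_nat_Units_padic_ints[OF prime_p n])
  have "(\<ominus>\<^bsub>R\<^esub> (inv\<^bsub>R\<^esub> ?N)) \<otimes>\<^bsub>R\<^esub> (\<ominus>\<^bsub>R\<^esub> ?N) = \<one>\<^bsub>R\<^esub>"
    "(\<ominus>\<^bsub>R\<^esub> ?N) \<otimes>\<^bsub>R\<^esub> (\<ominus>\<^bsub>R\<^esub> (inv\<^bsub>R\<^esub> ?N)) = \<one>\<^bsub>R\<^esub>"
    using N by (simp_all add: R.l_minus R.r_minus)
  moreover have "\<ominus>\<^bsub>R\<^esub> (inv\<^bsub>R\<^esub> ?N) \<in> carrier R" "\<ominus>\<^bsub>R\<^esub> ?N \<in> carrier R"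
    using N by simp_all
  ultimately have "\<ominus>\<^bsub>R\<^esub> ?N \<in> Units R"
    unfolding Units_def by blast
  then have U: "u \<in> Units R" unfolding u_def by (induction k) auto
  then show "inv\<^bsub>R\<^esub> u \<in> carrier R" by simp
  have "[([n] \<cdot>\<^bsub>R\<^esub> \<one>\<^bsub>R\<^esub>) 1 = int n] (mod int p)"
    by (simp add: padic_ints_of_nat)
  then have "[(\<ominus>\<^bsub>R\<^esub> ([n] \<cdot>\<^bsub>R\<^esub> \<one>\<^bsub>R\<^esub>)) 1 = - int n] (mod int p)"
    by (intro cong_trans[OF residue_a_inv]) (simp_all add: cong_minus_minus_iff)
  then have u1: "[u 1 = (- int n) ^ k] (mod int p)"
    unfolding u_def by (intro cong_trans[OF residue_pow] cong_pow) simp_all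
  have "[u 1 * (inv\<^bsub>R\<^esub> u) 1 = 1] (mod int p)"
    using residue_mult[of u "inv\<^bsub>R\<^esub> u"] residue_one U by (metis R.Units_r_inv cong_sym cong_trans)
  then have inv: "[(- int n) ^ k * (inv\<^bsub>R\<^esub> u) 1 = 1] (mod int p)"
    using cong_trans[OF cong_mult[OF cong_sym[OF u1] cong_refl]] by blast
  have one: "[(- m) ^ k * (- int n) ^ k = 1] (mod int p)"
    using cong_pow[OF mn, of k] by (simp add: mult.commute flip: power_mult_distrib)
  \<comment> \<open>Uniqueness of inverses modulo \<open>p\<close>: \<open>(- m) ^ k\<close> and the
    residue of \<open>inv u\<close> both invert \<open>(- int n) ^ k\<close>.\<close>
  have "[(inv\<^bsub>R\<^esub> u) 1 = ((- m) ^ k * (- int n) ^ k) * (inv\<^bsub>R\<^esub> u) 1] (mod int p)"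
    using cong_mult[OF cong_sym[OF one] cong_refl[of "(inv\<^bsub>R\<^esub> u) 1"]] by simp
  moreover have "[(- m) ^ k * ((- int n) ^ k * (inv\<^bsub>R\<^esub> u) 1) = (- m) ^ k * 1] (mod int p)"
    by (intro cong_mult inv cong_refl)
  ultimately show "[(inv\<^bsub>R\<^esub> u) 1 = (- m) ^ k] (mod int p)"
    unfolding mult.assoc mult_1_right by (rule cong_trans)
qed

end

theorem theorem1p2:
  fixes a n p :: nat
  assumes "a > 0" and "n > 0" and "prime p" and "\<not> p dvd n"
  defines "R \<equiv> padic_ints p"
  defines "P \<equiv> padic_poly p"
  defines "X \<equiv> poly_var R"
  shows "padic_poly_cong p
    (((\<ominus>\<^bsub>P\<^esub> X) [^]\<^bsub>P\<^esub> n) \<otimes>\<^bsub>P\<^esub>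
      (\<Oplus>\<^bsub>P\<^esub>k\<in>{1..p ^ a - 1}.
        inv\<^bsub>R\<^esub> ((\<ominus>\<^bsub>R\<^esub> ([n] \<cdot>\<^bsub>R\<^esub> \<one>\<^bsub>R\<^esub>)) [^]\<^bsub>R\<^esub> k) \<odot>\<^bsub>P\<^esub> bell_poly R k))
    (\<ominus>\<^bsub>P\<^esub> (\<Oplus>\<^bsub>P\<^esub>r\<in>{1..a}. (X [^]\<^bsub>P\<^esub> (p ^ r)) \<otimes>\<^bsub>P\<^esub>
      (\<Oplus>\<^bsub>P\<^esub>k\<in>{0..n - 1}.
        [(fact (n - 1) div fact k :: nat)] \<cdot>\<^bsub>P\<^esub> ((\<ominus>\<^bsub>P\<^esub> X) [^]\<^bsub>P\<^esub> k))))"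
proof -
  interpret red: padic_reduction p
    by unfold_locales (rule assms(3))
  have "coprime (int n) (int p)"
    using prime_imp_coprime[OF assms(3,4)] by (simp add: coprime_commute)
  then obtain m where mn: "[int n * m = 1] (mod int p)"
    using cong_solve_coprime_int by blast
  show ?thesis
    unfolding R_def P_def X_def
    \<comment> \<open>The integer polynomials of \<open>int_bell_sum_pcong\<close> mirror the two
      sides term by term, so the \<open>lifts\<close> rules follow the syntax.\<close>
    by (rule red.padic_poly_congI[OF _ _ int_bell_sum_pcong[OF assms(3,2) mn, of a]])
      (intro red.lifts_mult red.lifts_pow red.lifts_a_inv red.lifts_X red.lifts_finsum
        red.lifts_smult red.lifts_add_pow red.lifts_bell_poly
        red.residue_inv_neg_power[OF assms(4) mn])+
qed

end
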